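(* Let $\phi: B_a\to\mathbb{R}^N$ be a homeomorphism from $B_a$ onto $\mathbb{R}^N$ with $\phi(0)=0$ and $\phi=\nabla\Phi$ on $B_a$, where $\Phi:\overline{B}_a\to\mathbb{R}$ is of class $C^1$ on $B_a$, continuous and strictly convex on $\overline{B}_a$, and $\Phi(0)=0$. Let $\gamma:\mathbb{R}^N\times\mathbb{R}^N\to 2^{\mathbb{R}^N\times\mathbb{R}^N}$ be a maximal monotone operator with $(0,0)\in\gamma(0,0)$, and let $f:\mathbb{Z}[1,T]\times(\mathbb{R}^N)^{T+2}\to\mathbb{R}^N$ be continuous. Define $$\mathcal{K}(a,\gamma)=\{w:\mathbb{Z}[0,T+1]\to\mathbb{R}^N \,:\, \|\Delta w\|_\infty<a,\ (w(0),w(T+1))\in D(\gamma)\},$$ $$\lambda_1=\inf\left\{\frac{\sum_{n=1}^{T+1}|\Delta w(n-1)|^2}{\sum_{n=1}^{T}|w(n)|^2} \,:\, w\in\mathcal{K}(a,\gamma),\ w|_{\mathbb{Z}[1,T]}\neq 0\right\}.$$ If $\lambda_1>0$, then the problem $$\begin{cases}-\Delta[\phi(\Delta u(n-1))]=f(n,u(0),u(1),\dots,u(T+1)) & (n\in\mathbb{Z}[1,T]),\\ (\phi(\Delta u(0)),-\phi(\Delta u(T)))\in\gamma(u(0),u(T+1))\end{cases}$$ has at least one solution.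
   Context: $N\ge 1$ and $T\ge 2$ are fixed integers and $a>0$ is fixed. $|\cdot|$ is the Euclidean norm on $\mathbb{R}^N$, and $\mathbb{R}^N\times\mathbb{R}^N$ carries its usual inner product (monotonicity is understood with respect to it). $B_a=\{x\in\mathbb{R}^N:|x|<a\}$. $\mathbb{Z}[p,q]=\{p,p+1,\dots,q\}$. For $u:\mathbb{Z}[0,T+1]\to\mathbb{R}^N$: $\Delta u(n-1)=u(n)-u(n-1)$, $\Delta[\phi(\Delta u(n-1))]=\phi(\Delta u(n))-\phi(\Delta u(n-1))$, and $\|\Delta u\|_\infty=\max_{n\in\mathbb{Z}[1,T+1]}|\Delta u(n-1)|$. $D(\gamma)=\{z:\gamma(z)\ne\emptyset\}$. A solution of the problem is a function $u:\mathbb{Z}[0,T+1]\to\mathbb{R}^N$ with $\|\Delta u\|_\infty<a$ and $(u(0),u(T+1))\in D(\gamma)$ that satisfies both the equations and the boundary condition. *)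

theory Defs
  imports "HOL-Analysis.Analysis"
begin

definition C1_on :: "('a::real_inner \<Rightarrow> real) \<Rightarrow> 'a set \<Rightarrow> bool" where
  "C1_on \<Phi> S \<longleftrightarrow> (\<exists>G. (\<forall>x\<in>S. GDERIV \<Phi> x :> G x) \<and> continuous_on S G)"

definition strictly_convex_on :: "'a::real_vector set \<Rightarrow> ('a \<Rightarrow> real) \<Rightarrow> bool" where
  "strictly_convex_on S \<Phi> \<longleftrightarrow> convex S \<and>
     (\<forall>x\<in>S. \<forall>y\<in>S. \<forall>t. x \<noteq> y \<longrightarrow> 0 < t \<longrightarrow> t < 1 \<longrightarrow>
        \<Phi> ((1 - t) *\<^sub>R x + t *\<^sub>R y) < (1 - t) * \<Phi> x + t * \<Phi> y)"

definition monotone_operator :: "('a::real_inner \<Rightarrow> 'a set) \<Rightarrow> bool" where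
  "monotone_operator \<gamma> \<longleftrightarrow>
     (\<forall>z z'. \<forall>v\<in>\<gamma> z. \<forall>v'\<in>\<gamma> z'. 0 \<le> (v - v') \<bullet> (z - z'))"

definition maximal_monotone :: "('a::real_inner \<Rightarrow> 'a set) \<Rightarrow> bool" where
  "maximal_monotone \<gamma> \<longleftrightarrow> monotone_operator \<gamma> \<and>
     (\<forall>\<gamma>'. monotone_operator \<gamma>' \<longrightarrow> (\<forall>z. \<gamma> z \<subseteq> \<gamma>' z) \<longrightarrow> \<gamma>' = \<gamma>)"

definition op_domain :: "('a \<Rightarrow> 'b set) \<Rightarrow> 'a set" where
  "op_domain \<gamma> = {z. \<gamma> z \<noteq> {}}"

text \<open>A function on the integer interval from \<open>0\<close> to \<open>T + 1\<close> is an element of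
  \<open>{0..T+1} \<rightarrow>\<^sub>E UNIV\<close>, which is also the carrier of the product of \<open>T + 2\<close> copies of the
  space of values, and so the argument type of the nonlinearity \<open>f\<close>.\<close>

definition grid_functions :: "nat \<Rightarrow> (nat \<Rightarrow> 'a) set" where
  "grid_functions T = {0..T+1} \<rightarrow>\<^sub>E UNIV"

definition fwd_diff :: "(nat \<Rightarrow> 'a::minus) \<Rightarrow> nat \<Rightarrow> 'a" where
  "fwd_diff u n = u (n + 1) - u n"

definition diff_sup_norm :: "nat \<Rightarrow> (nat \<Rightarrow> 'a::real_normed_vector) \<Rightarrow> real" where
  "diff_sup_norm T u = Max ((\<lambda>n. norm (fwd_diff u (n - 1))) ` {1..T+1})"

definition K_set ::
  "nat \<Rightarrow> real \<Rightarrow> ('a::real_normed_vector \<times> 'a \<Rightarrow> ('a \<times> 'a) set) \<Rightarrow> (nat \<Rightarrow> 'a) set" where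
  "K_set T a \<gamma> = {w \<in> grid_functions T.
     diff_sup_norm T w < a \<and> (w 0, w (T + 1)) \<in> op_domain \<gamma>}"

text \<open>If \<open>(0,0)\<close> is in the domain of \<open>\<gamma>\<close>, \<open>T \<ge> 1\<close>, \<open>a > 0\<close> and the space is nontrivial, the
  infimum is over a nonempty set of nonnegative reals, so \<^const>\<open>Inf\<close> is the true infimum.\<close>

definition lambda1 ::
  "nat \<Rightarrow> real \<Rightarrow> ('a::real_normed_vector \<times> 'a \<Rightarrow> ('a \<times> 'a) set) \<Rightarrow> real" where
  "lambda1 T a \<gamma> = Inf {(\<Sum>n=1..T+1. (norm (fwd_diff w (n - 1)))\<^sup>2) / (\<Sum>n=1..T. (norm (w n))\<^sup>2)
     | w. w \<in> K_set T a \<gamma> \<and> (\<exists>n\<in>{1..T}. w n \<noteq> 0)}"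

definition is_solution ::
  "nat \<Rightarrow> real \<Rightarrow> ('a::real_normed_vector \<Rightarrow> 'a) \<Rightarrow> ('a \<times> 'a \<Rightarrow> ('a \<times> 'a) set) \<Rightarrow>
   (nat \<Rightarrow> (nat \<Rightarrow> 'a) \<Rightarrow> 'a) \<Rightarrow> (nat \<Rightarrow> 'a) \<Rightarrow> bool" where
  "is_solution T a \<phi> \<gamma> f u \<longleftrightarrow>
     u \<in> grid_functions T \<and>
     diff_sup_norm T u < a \<and>
     (u 0, u (T + 1)) \<in> op_domain \<gamma> \<and>
     (\<forall>n\<in>{1..T}. - fwd_diff (\<lambda>k. \<phi> (fwd_diff u k)) (n - 1) = f n u) \<and>
     (\<phi> (fwd_diff u 0), - \<phi> (fwd_diff u T)) \<in> \<gamma> (u 0, u (T + 1))"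

end

theory Submission
  imports Defs
begin

text \<open>
  The unknown is enlarged by the fluxes \<open>p n = \<phi> (u n - u (n - 1))\<close>, \<open>1 \<le> n \<le> T + 1\<close>. With
  \<open>\<psi> = \<phi>\<inverse>\<close>, which is continuous on the whole space and has values in the ball of radius \<open>a\<close>, the
  problem becomes
  \<open>p k - p (k + 1) = f k u\<close>, \<open>u n - u (n - 1) = \<psi> (p n)\<close> and
  \<open>(p 1, - p (T + 1)) \<in> \<gamma> (u 0, u (T + 1))\<close>.
  This is an inclusion \<open>0 \<in> V x + \<Gamma> x\<close> for \<open>x = (u, p)\<close>, in which \<open>V\<close> is continuous and everywhere
  defined, and \<open>\<Gamma>\<close> is \<open>\<gamma>\<close> acting on the two end values of \<open>u\<close>. The coupling of \<open>u\<close> and \<open>p\<close> is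
  skew-symmetric (summation by parts), so in \<open>V x \<bullet> x\<close> it cancels, and there remain only
  \<open>\<Sum> \<psi> (p n) \<bullet> p n\<close> and terms in \<open>u\<close> alone. The first is coercive in \<open>p\<close>, since \<open>\<phi>\<close> is monotone as
  the gradient of a convex function (\<open>monotone_inverse_coercive\<close>).

  Coercivity in \<open>u\<close> comes from \<open>\<lambda>\<^sub>1 > 0\<close>: all elements of \<open>K_set T a \<gamma>\<close> are bounded by one constant
  \<open>R\<close> (\<open>K_set_bounded\<close>). Hence \<open>f k u\<close> may be replaced by \<open>f k (P u) - (u k - P (u k))\<close>, where \<open>P\<close> is
  the projection of each value to the ball of radius \<open>R\<close>; the penalty \<open>u k - P (u k)\<close> is also added
  to the two end equations. Any solution \<open>u\<close> of the modified problem has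
  \<open>\<bar>\<Delta>u\<bar> < a\<close>, because \<open>\<Delta>u\<close> is a value of \<open>\<psi>\<close>, and its end values are in the domain of \<open>\<gamma>\<close>. So it
  lies in \<open>K_set T a \<gamma>\<close>, and \<open>P u = u\<close>: it solves the original problem.

  The modified inclusion is solvable by \<open>coercive_inclusion_solvable\<close>. By maximality of \<open>\<gamma>\<close> it is
  equivalent to a family of inequalities \<open>(V x + W) \<bullet> (x - X) \<le> 0\<close> indexed by the graph of \<open>\<Gamma>\<close>. The one
  for \<open>X = W = 0\<close> confines \<open>x\<close> to a compact set, so finitely many of them need to be solved at a time.
  That is the lemma of Debrunner and Flor, which follows from Brouwer's fixed point theorem for the
  coefficients of linear combinations of the points \<open>X\<close>. As the number of coefficients is arbitrary,
  Brouwer's theorem is needed for cubes whose dimension is a natural number and not a type.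
\<close>

section \<open>Brouwer's theorem for cubes of variable dimension\<close>

lemma compact_box_fun:
  fixes S :: "'i \<Rightarrow> 'a::topological_space set"
  assumes "\<And>i. compact (S i)"
  shows "compact {x. \<forall>i. x i \<in> S i}"
proof -
  have "compactin (product_topology (\<lambda>_::'i. euclidean) UNIV) (PiE UNIV S)"
    unfolding compactin_PiE using assms by simp
  moreover have "PiE UNIV S = {x. \<forall>i. x i \<in> S i}"
    by (auto simp: PiE_def Pi_def)
  ultimately show ?thesis
    unfolding euclidean_product_topology by simp
qed

lemma tendsto_fun_iff:
  fixes f :: "'b \<Rightarrow> 'i \<Rightarrow> 'a::topological_space"
  shows "(f \<longlongrightarrow> l) F \<longleftrightarrow> (\<forall>i. ((\<lambda>x. f x i) \<longlongrightarrow> l i) F)"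
  using limitin_componentwise[of "\<lambda>_::'i. euclidean" UNIV f l F]
  by (simp add: euclidean_product_topology)

text \<open>
  Brouwer's fixed point theorem for \<open>[0, 1]\<^sup>d\<close>, with the points encoded as functions on \<open>nat\<close> that vanish
  from \<open>d\<close> on. On finer and finer grids Kuhn's combinatorial lemma, applied to the sign of
  \<open>F x i - x i\<close>, yields points that are close, for each \<open>i\<close>, both to a point with \<open>x i \<le> F x i\<close> and to one
  with \<open>F x i \<le> x i\<close>. A limit of such points is a fixed point.
\<close>
lemma brouwer_cube_fun:
  fixes F :: "(nat \<Rightarrow> real) \<Rightarrow> nat \<Rightarrow> real" and d :: nat
  defines "Q \<equiv> {x. \<forall>i. x i \<in> (if i < d then {0..1} else {0})}"
  assumes cont: "\<And>i. i < d \<Longrightarrow> continuous_on Q (\<lambda>x. F x i)"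
    and maps: "\<And>x i. x \<in> Q \<Longrightarrow> i < d \<Longrightarrow> F x i \<in> {0..1}"
  obtains x where "x \<in> Q" "\<And>i. i < d \<Longrightarrow> F x i = x i"
proof -
  \<comment> \<open>Kuhn's lemma prescribes the labels on the faces of the cube; there they take precedence over the sign.\<close>
  define lab where "lab x i = (if x i = 0 then 0 else if x i = 1 \<or> F x i < x i then 1 else (0::nat))"
    for x :: "nat \<Rightarrow> real" and i
  have lab0: "x i \<le> F x i" if "x \<in> Q" "i < d" "lab x i = 0" for x i
    using maps[OF that(1,2)] that(3) by (auto simp: lab_def split: if_splits)
  have lab1: "F x i \<le> x i" if "x \<in> Q" "i < d" "lab x i \<noteq> 0" for x i
    using maps[OF that(1,2)] that(3) by (auto simp: lab_def split: if_splits)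
  define g where "g p q = (\<lambda>i. if i < d then real (q i) / real p else 0)" for p :: nat and q :: "nat \<Rightarrow> nat"
  have gQ: "g p q \<in> Q" if "p > 0" "\<forall>i<d. q i \<le> p" for p q
    using that by (auto simp: Q_def g_def)
  define Lo Hi where "Lo i = {x \<in> Q. x i \<le> F x i}" and "Hi i = {x \<in> Q. F x i \<le> x i}" for i
  define close where "close k x y \<longleftrightarrow> (\<forall>j. \<bar>y j - x j\<bar> \<le> 1 / real (Suc k))" for k and x y :: "nat \<Rightarrow> real"
  have step: "\<exists>c\<in>Q. \<forall>i<d. (\<exists>y\<in>Lo i. close k c y) \<and> (\<exists>z\<in>Hi i. close k c z)" for k
  proof -
    let ?p = "Suc k"
    have "\<exists>q. (\<forall>i<d. q i < ?p) \<and>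
      (\<forall>i<d. \<exists>r s. (\<forall>j<d. q j \<le> r j \<and> r j \<le> q j + 1) \<and> (\<forall>j<d. q j \<le> s j \<and> s j \<le> q j + 1) \<and>
          lab (g ?p r) i \<noteq> lab (g ?p s) i)"
    proof (rule kuhn_lemma[of ?p d "\<lambda>q. lab (g ?p q)"])
      show "\<forall>x. (\<forall>i<d. x i \<le> ?p) \<longrightarrow> (\<forall>i<d. x i = ?p \<longrightarrow> lab (g ?p x) i = 1)"
        by (simp add: lab_def g_def)
      show "\<forall>x. (\<forall>i<d. x i \<le> ?p) \<longrightarrow> (\<forall>i<d. x i = 0 \<longrightarrow> lab (g ?p x) i = 0)"
        by (simp add: lab_def g_def)
      show "\<forall>x. (\<forall>i<d. x i \<le> ?p) \<longrightarrow> (\<forall>i<d. lab (g ?p x) i = 0 \<or> lab (g ?p x) i = 1)"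
        by (simp add: lab_def)
    qed (simp, rule exI, rule conjI)
    then obtain q where q: "\<forall>i<d. q i < ?p"
      and rs: "\<And>i. i < d \<Longrightarrow> \<exists>r s. (\<forall>j<d. q j \<le> r j \<and> r j \<le> q j + 1) \<and>
          (\<forall>j<d. q j \<le> s j \<and> s j \<le> q j + 1) \<and> lab (g ?p r) i \<noteq> lab (g ?p s) i"
      by blast
    have near: "close k (g ?p q) (g ?p r)" if "\<forall>j<d. q j \<le> r j \<and> r j \<le> q j + 1" for r
      unfolding close_def
    proof
      fix j
      show "\<bar>g ?p r j - g ?p q j\<bar> \<le> 1 / real ?p"
      proof (cases "j < d")
        case True
        then have "\<bar>real (r j) - real (q j)\<bar> \<le> 1" using that by fastforce
        then show ?thesis
          using True by (simp add: g_def divide_simps flip: diff_divide_distrib)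
      qed (simp add: g_def)
    qed
    have inQ: "g ?p r \<in> Q" if "\<forall>j<d. q j \<le> r j \<and> r j \<le> q j + 1" for r
    proof (rule gQ)
      show "\<forall>i<d. r i \<le> ?p"
      proof (intro allI impI)
        fix i assume "i < d"
        then have "r i \<le> q i + 1" "q i < ?p" using that q by auto
        then show "r i \<le> ?p" by simp
      qed
    qed simp
    show ?thesis
    proof (rule bexI[of _ "g ?p q"], intro allI impI)
      fix i assume i: "i < d"
      obtain r s where r: "\<forall>j<d. q j \<le> r j \<and> r j \<le> q j + 1"
        and s: "\<forall>j<d. q j \<le> s j \<and> s j \<le> q j + 1" and ne: "lab (g ?p r) i \<noteq> lab (g ?p s) i"
        using rs[OF i] by blast
      have "lab (g ?p r) i = 0 \<and> lab (g ?p s) i \<noteq> 0 \<or> lab (g ?p s) i = 0 \<and> lab (g ?p r) i \<noteq> 0"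
        using ne by (auto simp: lab_def split: if_splits)
      then show "(\<exists>y\<in>Lo i. close k (g ?p q) y) \<and> (\<exists>z\<in>Hi i. close k (g ?p q) z)"
        unfolding Lo_def Hi_def
        using near[OF r] near[OF s] inQ[OF r] inQ[OF s] lab0 lab1 i by blast
    qed (auto intro: inQ)
  qed
  obtain c where c: "\<And>k. c k \<in> Q"
    and Lo: "\<And>k i. i < d \<Longrightarrow> \<exists>y\<in>Lo i. close k (c k) y"
    and Hi: "\<And>k i. i < d \<Longrightarrow> \<exists>z\<in>Hi i. close k (c k) z"
    using step by metis
  have "compact Q"
    unfolding Q_def by (rule compact_box_fun) auto
  then obtain l \<sigma> where l: "l \<in> Q" and \<sigma>: "strict_mono \<sigma>" and lim: "(c \<circ> \<sigma>) \<longlonglongrightarrow> l"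
    using c unfolding compact_eq_seq_compact_metric seq_compact_def by metis
  have limw: "(\<lambda>k. w (\<sigma> k)) \<longlonglongrightarrow> l"
    if w: "\<And>k. close k (c k) (w k)" for w :: "nat \<Rightarrow> nat \<Rightarrow> real"
    unfolding tendsto_fun_iff
  proof
    fix j
    have "(\<lambda>k. w k j - c k j) \<longlonglongrightarrow> 0"
      by (rule Lim_null_comparison[OF _ LIMSEQ_inverse_real_of_nat])
        (use w in \<open>auto simp: close_def inverse_eq_divide\<close>)
    then have "(\<lambda>k. w (\<sigma> k) j - c (\<sigma> k) j) \<longlonglongrightarrow> 0"
      using LIMSEQ_subseq_LIMSEQ[OF _ \<sigma>] by (fastforce simp: o_def)
    moreover have "(\<lambda>k. c (\<sigma> k) j) \<longlonglongrightarrow> l j"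
      using lim unfolding tendsto_fun_iff by (simp add: o_def)
    ultimately show "(\<lambda>k. w (\<sigma> k) j) \<longlonglongrightarrow> l j"
      using tendsto_add by fastforce
  qed
  have "F l i = l i" if i: "i < d" for i
  proof (rule antisym)
    obtain y where y: "\<And>k. y k \<in> Lo i" "\<And>k. close k (c k) (y k)"
      using Lo[OF i] by metis
    obtain z where z: "\<And>k. z k \<in> Hi i" "\<And>k. close k (c k) (z k)"
      using Hi[OF i] by metis
    have Y: "(\<lambda>k. y (\<sigma> k)) \<longlonglongrightarrow> l" and Z: "(\<lambda>k. z (\<sigma> k)) \<longlonglongrightarrow> l"
      using limw y(2) z(2) by blast+
    have lim_F: "(\<lambda>k. F (w (\<sigma> k)) i) \<longlonglongrightarrow> F l i" if "\<And>k. w k \<in> Q" "(\<lambda>k. w (\<sigma> k)) \<longlonglongrightarrow> l" for w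
      by (rule continuous_on_tendsto_compose[OF cont[OF i] that(2) l]) (simp add: that(1))
    have FY: "(\<lambda>k. F (y (\<sigma> k)) i) \<longlonglongrightarrow> F l i" and FZ: "(\<lambda>k. F (z (\<sigma> k)) i) \<longlonglongrightarrow> F l i"
      using lim_F[OF _ Y] lim_F[OF _ Z] y(1) z(1) unfolding Lo_def Hi_def by blast+
    have Yi: "(\<lambda>k. y (\<sigma> k) i) \<longlonglongrightarrow> l i" and Zi: "(\<lambda>k. z (\<sigma> k) i) \<longlonglongrightarrow> l i"
      using Y Z unfolding tendsto_fun_iff by blast+
    show "l i \<le> F l i"
      using LIMSEQ_le[OF Yi FY] y(1) unfolding Lo_def by blast
    show "F l i \<le> l i"
      using LIMSEQ_le[OF FZ Zi] z(1) unfolding Hi_def by blast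
  qed
  then show thesis using l that by blast
qed

section \<open>Coercive perturbations of maximal monotone operators\<close>

text \<open>
  If the inequalities had no common solution among the linear combinations of the points \<open>X j\<close>, then the
  coefficients could be replaced continuously by the normalised violations of the inequalities. At a
  fixed point the coefficients are nonnegative, have sum \<open>1\<close>, and weight only violated inequalities;
  but then the terms with \<open>V\<close> cancel and the remaining ones have the wrong sign by monotonicity.
\<close>
lemma debrunner_flor_finite:
  fixes V :: "('i \<Rightarrow> 'a::real_inner) \<Rightarrow> 'i \<Rightarrow> 'a" and X W :: "nat \<Rightarrow> 'i \<Rightarrow> 'a"
  assumes cont: "\<And>i. i \<in> I \<Longrightarrow> continuous_on UNIV (\<lambda>x. V x i)"
    and mono: "\<And>j k. j < m \<Longrightarrow> k < m \<Longrightarrow> 0 \<le> (\<Sum>i\<in>I. (W j i - W k i) \<bullet> (X j i - X k i))"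
  obtains t where
    "\<And>j. j < m \<Longrightarrow> (\<Sum>i\<in>I. (V (\<lambda>i. \<Sum>k<m. t k *\<^sub>R X k i) i + W j i) \<bullet> ((\<Sum>k<m. t k *\<^sub>R X k i) - X j i)) \<le> 0"
proof -
  define y where "y t = (\<lambda>i. \<Sum>k<m. t k *\<^sub>R X k i)" for t :: "nat \<Rightarrow> real"
  define h where "h j x = (\<Sum>i\<in>I. (V x i + W j i) \<bullet> (x i - X j i))" for j x
  have "\<exists>t. \<forall>j<m. h j (y t) \<le> 0"
  proof (rule ccontr)
    assume "\<not> ?thesis"
    then have pos: "\<exists>j<m. h j (y t) > 0" for t
      by (meson not_le)
    define g where "g j x = max 0 (h j x)" for j x
    define S where "S x = (\<Sum>j<m. g j x)" for x
    have S: "S (y t) > 0" for t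
    proof -
      obtain j where "j < m" "h j (y t) > 0" using pos by blast
      then show ?thesis
        unfolding S_def by (intro sum_pos2[of _ j]) (auto simp: g_def)
    qed
    have conty: "continuous_on A y" for A
      unfolding y_def
      by (intro continuous_intros continuous_on_subset[OF continuous_on_product_coordinates]) auto
    have conth: "continuous_on UNIV (h j)" for j
      unfolding h_def by (intro continuous_intros cont continuous_on_product_coordinates)
    have contg: "continuous_on A (\<lambda>t. g j (y t))" for A j
      unfolding g_def
      by (intro continuous_intros continuous_on_compose2[OF conth conty]) auto
    obtain t where tQ: "t \<in> {x. \<forall>i. x i \<in> (if i < m then {0..1} else {0})}"
      and fix_t: "\<And>j. j < m \<Longrightarrow> g j (y t) / S (y t) = t j"
    proof (rule brouwer_cube_fun[of m "\<lambda>t j. g j (y t) / S (y t)"])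
      fix j assume "j < m"
      show "continuous_on {x. \<forall>i. x i \<in> (if i < m then {0..1} else {0})} (\<lambda>t. g j (y t) / S (y t))"
        using S less_imp_neq unfolding S_def by (intro continuous_intros contg) fastforce
    next
      fix t :: "nat \<Rightarrow> real" and j assume "j < m"
      then have "g j (y t) \<le> S (y t)"
        unfolding S_def by (intro member_le_sum) (auto simp: g_def)
      then show "g j (y t) / S (y t) \<in> {0..1}"
        using S[of t] by (simp add: g_def)
    qed (rule that)
    have t0: "t j \<ge> 0" if "j < m" for j
    proof -
      have "t j \<in> (if j < m then {0..1} else {0})" using tQ by blast
      then show ?thesis using that by simp
    qed
    \<comment> \<open>The sum of the coefficients is \<open>1\<close> at a fixed point only, not on all of the cube.\<close>
    have t1: "(\<Sum>j<m. t j) = 1"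
    proof -
      have "(\<Sum>j<m. t j) = (\<Sum>j<m. g j (y t) / S (y t))" using fix_t by simp
      also have "\<dots> = 1" using S[of t] by (simp add: S_def flip: sum_divide_distrib)
      finally show ?thesis .
    qed
    have "0 < (\<Sum>j<m. t j * h j (y t))"
    proof -
      have th: "t j * h j (y t) = (g j (y t))\<^sup>2 / S (y t)" if "j < m" for j
        unfolding fix_t[OF that, symmetric] by (auto simp: g_def power2_eq_square max_def)
      obtain j where j: "j < m" "h j (y t) > 0" using pos by blast
      show ?thesis
      proof (rule sum_pos2[of _ j])
        show "0 < t j * h j (y t)"
          using j S[of t] by (simp add: th[OF j(1)] g_def)
        show "0 \<le> t k * h k (y t)" if "k \<in> {..<m}" for k
          using that S[of t] th[of k] by simp
      qed (use j in auto)
    qed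
    moreover have "(\<Sum>j<m. t j * h j (y t)) \<le> 0"
    proof -
      define w where "w j k = (\<Sum>i\<in>I. W j i \<bullet> (X k i - X j i))" for j k
      have yX: "y t i - X j i = (\<Sum>k<m. t k *\<^sub>R (X k i - X j i))" for i j
        by (simp add: y_def scaleR_diff_right sum_subtractf t1 flip: scaleR_sum_left)
      have "(\<Sum>j<m. t j * (\<Sum>i\<in>I. V (y t) i \<bullet> (y t i - X j i)))
          = (\<Sum>i\<in>I. V (y t) i \<bullet> (\<Sum>j<m. t j *\<^sub>R (y t i - X j i)))"
        unfolding sum_distrib_left inner_sum_right by (subst sum.swap) simp
      also have "\<dots> = 0"
        by (simp add: scaleR_diff_right sum_subtractf t1 flip: scaleR_sum_left) (simp add: y_def)
      finally have V0: "(\<Sum>j<m. t j * (\<Sum>i\<in>I. V (y t) i \<bullet> (y t i - X j i))) = 0" .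
      have Ww: "(\<Sum>i\<in>I. W j i \<bullet> (y t i - X j i)) = (\<Sum>k<m. t k * w j k)" for j
        unfolding yX w_def sum_distrib_left inner_sum_right by (subst sum.swap) simp
      have "(\<Sum>j<m. t j * h j (y t)) = (\<Sum>j<m. t j * (\<Sum>k<m. t k * w j k))"
        using V0 by (simp add: h_def inner_add_left sum.distrib distrib_left Ww)
      also have "\<dots> = (\<Sum>j<m. \<Sum>k<m. t j * t k * w j k)"
        by (simp add: sum_distrib_left mult.assoc)
      finally have A: "(\<Sum>j<m. t j * h j (y t)) = (\<Sum>j<m. \<Sum>k<m. t j * t k * w j k)" .
      also have "\<dots> = (\<Sum>j<m. \<Sum>k<m. t j * t k * w k j)"
        by (subst sum.swap) (simp add: mult.commute)
      finally have B: "(\<Sum>j<m. t j * h j (y t)) = (\<Sum>j<m. \<Sum>k<m. t j * t k * w k j)" .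
      have "2 * (\<Sum>j<m. t j * h j (y t)) = (\<Sum>j<m. \<Sum>k<m. t j * t k * (w j k + w k j))"
        using A B by (simp add: sum.distrib distrib_left)
      also have "\<dots> \<le> 0"
      proof (intro sum_nonpos)
        fix j k assume jk: "j \<in> {..<m}" "k \<in> {..<m}"
        have "w j k + w k j = - (\<Sum>i\<in>I. (W j i - W k i) \<bullet> (X j i - X k i))"
          unfolding w_def by (simp add: inner_diff sum_negf flip: sum.distrib)
            (simp add: algebra_simps flip: sum_negf)
        then have "w j k + w k j \<le> 0" using mono[of j k] jk by simp
        then show "t j * t k * (w j k + w k j) \<le> 0"
          using t0 jk by (intro mult_nonneg_nonpos) auto
      qed
      finally show ?thesis by simp
    qed
    ultimately show False by simp
  qed
  then show thesis
    using that unfolding h_def y_def by blast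
qed

text \<open>
  The same for an arbitrary monotone graph \<open>G\<close>. The coercivity bound, used with the pair \<open>(0, 0)\<close>, places
  the solutions of finite subfamilies in one compact set. Functions \<open>X\<close> in the graph are to vanish off the
  index set \<open>I\<close>, because the coercivity bound does not control the other coordinates.
\<close>
lemma debrunner_flor:
  fixes V :: "('i \<Rightarrow> 'a::euclidean_space) \<Rightarrow> 'i \<Rightarrow> 'a"
    and G :: "(('i \<Rightarrow> 'a) \<times> ('i \<Rightarrow> 'a)) set"
  assumes cont: "\<And>i. i \<in> I \<Longrightarrow> continuous_on UNIV (\<lambda>x. V x i)"
    and mono: "\<And>X W X' W'. (X, W) \<in> G \<Longrightarrow> (X', W') \<in> G \<Longrightarrow>
      0 \<le> (\<Sum>i\<in>I. (W i - W' i) \<bullet> (X i - X' i))"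
    and supp: "\<And>X W i. (X, W) \<in> G \<Longrightarrow> i \<notin> I \<Longrightarrow> X i = 0"
    and zero: "(\<lambda>_. 0, \<lambda>_. 0) \<in> G"
    and bound: "\<And>x i. (\<Sum>i\<in>I. V x i \<bullet> x i) \<le> 0 \<Longrightarrow> i \<in> I \<Longrightarrow> norm (x i) \<le> B"
  obtains x where "\<And>X W. (X, W) \<in> G \<Longrightarrow> (\<Sum>i\<in>I. (V x i + W i) \<bullet> (x i - X i)) \<le> 0"
proof -
  define C :: "('i \<Rightarrow> 'a) set" where "C = {x. \<forall>i. x i \<in> (if i \<in> I then cball 0 B else {0})}"
  define H where "H p = {x. (\<Sum>i\<in>I. (V x i + snd p i) \<bullet> (x i - fst p i)) \<le> 0}" for p
  have "C \<inter> (\<Inter>p\<in>G. H p) \<noteq> {}"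
  proof (rule compact_imp_fip_image)
    show "compact C"
      unfolding C_def by (rule compact_box_fun) auto
    show "closed (H p)" for p
      unfolding H_def
      by (intro closed_Collect_le continuous_intros cont continuous_on_product_coordinates)
    fix G' assume G': "finite G'" "G' \<subseteq> G"
    \<comment> \<open>The pair of zero functions is added to have the coercivity bound at hand.\<close>
    let ?P = "insert (\<lambda>_. 0, \<lambda>_. 0) G'"
    have PG: "?P \<subseteq> G" using G' zero by auto
    obtain m and e :: "nat \<Rightarrow> _" where e: "bij_betw e {..<m} ?P"
      using ex_bij_betw_nat_finite[of ?P] G'(1) by (auto simp: atLeast0LessThan)
    have eG: "e j \<in> G" if "j < m" for j
      using bij_betwE[OF e] that PG by blast
    obtain t where t: "\<And>j. j < m \<Longrightarrow> (\<Sum>i\<in>I. (V (\<lambda>i. \<Sum>k<m. t k *\<^sub>R fst (e k) i) i + snd (e j) i)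
        \<bullet> ((\<Sum>k<m. t k *\<^sub>R fst (e k) i) - fst (e j) i)) \<le> 0"
      by (rule debrunner_flor_finite[of I V m "\<lambda>j. snd (e j)" "\<lambda>j. fst (e j)"])
        (use cont mono eG in auto)
    define x where "x = (\<lambda>i. \<Sum>k<m. t k *\<^sub>R fst (e k) i)"
    have xH: "x \<in> H p" if "p \<in> ?P" for p
    proof -
      obtain j where "j < m" "e j = p"
        using e \<open>p \<in> ?P\<close> by (metis bij_betw_def imageE lessThan_iff)
      then show ?thesis using t[of j] by (simp add: H_def x_def)
    qed
    have "x i = 0" if "i \<notin> I" for i
      using supp[of "fst p" "snd p" i for p] eG that by (simp add: x_def)
    moreover have "norm (x i) \<le> B" if "i \<in> I" for i
      using bound[of x] xH[of "(\<lambda>_. 0, \<lambda>_. 0)"] that by (simp add: H_def)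
    ultimately have "x \<in> C" by (simp add: C_def)
    then show "C \<inter> (\<Inter>p\<in>G'. H p) \<noteq> {}" using xH by blast
  qed
  then obtain x where "\<forall>p\<in>G. x \<in> H p" by blast
  then show thesis by (intro that[of x]) (auto simp: H_def)
qed

text \<open>
  A pair that is monotonically related to the whole graph of \<open>\<gamma>\<close> belongs to it.
\<close>
lemma maximal_monotoneD:
  assumes "maximal_monotone \<gamma>" and "\<And>z w. w \<in> \<gamma> z \<Longrightarrow> 0 \<le> (v - w) \<bullet> (y - z)"
  shows "v \<in> \<gamma> y"
proof -
  define \<gamma>' where "\<gamma>' z = \<gamma> z \<union> (if z = y then {v} else {})" for z
  have m: "0 \<le> (w - w') \<bullet> (z - z')" if "w \<in> \<gamma> z" "w' \<in> \<gamma> z'" for w w' z z'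
    using assms(1) that unfolding maximal_monotone_def monotone_operator_def by blast
  have flip: "0 \<le> (w - v) \<bullet> (z - y)" if "w \<in> \<gamma> z" for w z
    using assms(2)[OF that] by (simp add: inner_diff algebra_simps)
  have "monotone_operator \<gamma>'"
    unfolding monotone_operator_def \<gamma>'_def
    using m flip assms(2) by (auto split: if_splits)
  moreover have "\<gamma> z \<subseteq> \<gamma>' z" for z by (simp add: \<gamma>'_def)
  ultimately have "\<gamma>' = \<gamma>" using assms(1) unfolding maximal_monotone_def by blast
  then show ?thesis using \<gamma>'_def[of y] by auto
qed

text \<open>
  An equation \<open>V x i = 0\<close> for each coordinate \<open>i\<close> except two, which are tied by the inclusion in \<open>\<gamma>\<close>.
\<close>
lemma coercive_inclusion_solvable:
  fixes V :: "('i \<Rightarrow> 'a::euclidean_space) \<Rightarrow> 'i \<Rightarrow> 'a" and \<gamma> :: "'a \<times> 'a \<Rightarrow> ('a \<times> 'a) set"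
  assumes I: "finite I" "\<alpha> \<in> I" "\<beta> \<in> I" "\<alpha> \<noteq> \<beta>"
    and \<gamma>: "maximal_monotone \<gamma>" "(0, 0) \<in> \<gamma> (0, 0)"
    and cont: "\<And>i. i \<in> I \<Longrightarrow> continuous_on UNIV (\<lambda>x. V x i)"
    and bound: "\<And>x i. (\<Sum>i\<in>I. V x i \<bullet> x i) \<le> 0 \<Longrightarrow> i \<in> I \<Longrightarrow> norm (x i) \<le> B"
  obtains x where "(- V x \<alpha>, - V x \<beta>) \<in> \<gamma> (x \<alpha>, x \<beta>)"
    and "\<And>i. i \<in> I - {\<alpha>, \<beta>} \<Longrightarrow> V x i = 0"
proof -
  define J where "J = I - {\<alpha>, \<beta>}"
  have sumI: "(\<Sum>i\<in>I. g i) = g \<alpha> + g \<beta> + (\<Sum>i\<in>J. g i)" for g :: "'i \<Rightarrow> real"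
  proof -
    have "I = insert \<alpha> (insert \<beta> J)" "finite J" "\<alpha> \<notin> insert \<beta> J" "\<beta> \<notin> J"
      using I by (auto simp: J_def)
    then show ?thesis by simp
  qed
  define G where "G = {(X, W). (W \<alpha>, W \<beta>) \<in> \<gamma> (X \<alpha>, X \<beta>) \<and> (\<forall>i\<in>J. W i = 0) \<and> (\<forall>i. i \<notin> I \<longrightarrow> X i = 0)}"
  obtain x where x: "\<And>X W. (X, W) \<in> G \<Longrightarrow> (\<Sum>i\<in>I. (V x i + W i) \<bullet> (x i - X i)) \<le> 0"
  proof (rule debrunner_flor[of I V G B])
    fix X W X' W' assume "(X, W) \<in> G" "(X', W') \<in> G"
    moreover from this have "0 \<le> ((W \<alpha>, W \<beta>) - (W' \<alpha>, W' \<beta>)) \<bullet> ((X \<alpha>, X \<beta>) - (X' \<alpha>, X' \<beta>))"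
      using \<gamma>(1) unfolding maximal_monotone_def monotone_operator_def G_def by blast
    ultimately show "0 \<le> (\<Sum>i\<in>I. (W i - W' i) \<bullet> (X i - X' i))"
      unfolding sumI by (simp add: G_def)
  qed (use cont bound \<gamma>(2) in \<open>auto simp: G_def\<close>)
  \<comment> \<open>The coordinates of \<open>X\<close> other than \<open>\<alpha>\<close> and \<open>\<beta>\<close> are free in \<open>G\<close>, whence the arbitrary \<open>d\<close>.\<close>
  have key: "(V x \<alpha> + w0) \<bullet> (x \<alpha> - z0) + (V x \<beta> + w1) \<bullet> (x \<beta> - z1) + (\<Sum>i\<in>J. V x i \<bullet> d i) \<le> 0"
    if "(w0, w1) \<in> \<gamma> (z0, z1)" for z0 z1 w0 w1 d
  proof -
    define X where "X i = (if i = \<alpha> then z0 else if i = \<beta> then z1 else if i \<in> I then x i - d i else 0)" for i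
    define W where "W i = (if i = \<alpha> then w0 else if i = \<beta> then w1 else 0)" for i
    have "(X, W) \<in> G" using that I by (auto simp: G_def X_def W_def J_def)
    from x[OF this] show ?thesis
      unfolding sumI using I(4) by (simp add: X_def W_def J_def)
  qed
  have 1: "(- V x \<alpha>, - V x \<beta>) \<in> \<gamma> (x \<alpha>, x \<beta>)"
  proof (rule maximal_monotoneD[OF \<gamma>(1)])
    fix z w assume "w \<in> \<gamma> z"
    then show "0 \<le> ((- V x \<alpha>, - V x \<beta>) - w) \<bullet> ((x \<alpha>, x \<beta>) - z)"
      using key[of "fst w" "snd w" "fst z" "snd z" "\<lambda>_. 0"]
      by (cases w; cases z) (simp add: inner_diff inner_add_left algebra_simps)
  qed
  \<comment> \<open>With the pair just found in \<open>\<gamma>\<close> as \<open>(z, w)\<close> the terms at \<open>\<alpha>\<close> and \<open>\<beta>\<close> vanish.\<close>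
  have "(\<Sum>i\<in>J. V x i \<bullet> V x i) \<le> 0"
    using key[OF 1, of "V x"] by simp
  then have "V x i = 0" if "i \<in> J" for i
    using that I(1) sum_nonneg_eq_0_iff[of J "\<lambda>i. V x i \<bullet> V x i"]
      sum_nonneg[of J "\<lambda>i. V x i \<bullet> V x i"] by (fastforce simp: J_def)
  with 1 show thesis using that unfolding J_def by blast
qed

section \<open>Gradients of convex functions\<close>

lemma strictly_convex_on_imp_convex_on:
  assumes "strictly_convex_on S f"
  shows "convex_on S f"
proof (rule convex_onI)
  fix t :: real and x y assume *: "0 < t" "t < 1" "x \<in> S" "y \<in> S"
  show "f ((1 - t) *\<^sub>R x + t *\<^sub>R y) \<le> (1 - t) * f x + t * f y"
  proof (cases "x = y")
    case True
    then show ?thesis by (simp add: algebra_simps flip: scaleR_add_left)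
  next
    case False
    then show ?thesis using assms * unfolding strictly_convex_on_def by (simp add: less_imp_le)
  qed
qed (use assms in \<open>simp add: strictly_convex_on_def\<close>)

lemma convex_on_imp_above_tangent_plane:
  fixes f :: "'a::real_inner \<Rightarrow> real"
  assumes f: "convex_on S f" and S: "open S" and x: "x \<in> S" and y: "y \<in> S"
    and D: "GDERIV f x :> g"
  shows "g \<bullet> (y - x) \<le> f y - f x"
proof -
  define l where "l = (\<lambda>t. x + t *\<^sub>R (y - x))"
  define A where "A = {t. l t \<in> S}"
  have comb: "l (u * s + v * t) = u *\<^sub>R l s + v *\<^sub>R l t" if "u + v = 1" for u v s t
  proof -
    have "x = u *\<^sub>R x + v *\<^sub>R x" using that by (simp flip: scaleR_add_left)
    then show ?thesis by (simp add: l_def algebra_simps)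
  qed
  have "open A"
    unfolding A_def l_def using S by (intro open_vimage[unfolded vimage_def] continuous_intros)
  \<comment> \<open>\<open>A\<close> is an open interval around \<open>0\<close>, so the tangent inequality for functions of one real variable applies.\<close>
  have cA: "convex_on A (\<lambda>t. f (l t))"
    unfolding convex_on_def
  proof (intro conjI ballI allI impI)
    show "convex A"
      using convex_on_imp_convex[OF f] unfolding convex_def A_def by (simp add: comb)
    fix s t u v :: real assume "s \<in> A" "t \<in> A" "0 \<le> u" "0 \<le> v" "u + v = 1"
    then show "f (l (u *\<^sub>R s + v *\<^sub>R t)) \<le> u * f (l s) + v * f (l t)"
      using f unfolding convex_on_def A_def by (simp add: comb)
  qed
  have "(l has_derivative (\<lambda>h. h *\<^sub>R (y - x))) (at 0)"
    unfolding l_def by (auto intro!: derivative_eq_intros)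
  moreover have "(f has_derivative (\<lambda>h. h \<bullet> g)) (at (l 0))"
    using D by (simp add: gderiv_def l_def)
  ultimately have "((\<lambda>t. f (l t)) has_derivative (\<lambda>h. (h *\<^sub>R (y - x)) \<bullet> g)) (at 0)"
    using has_derivative_compose by blast
  then have "((\<lambda>t. f (l t)) has_field_derivative g \<bullet> (y - x)) (at 0)"
    unfolding has_field_derivative_def by (rule has_derivative_eq_rhs) (auto simp: inner_commute)
  then have "((\<lambda>t. f (l t)) has_field_derivative g \<bullet> (y - x)) (at 0 within A)"
    by (rule has_field_derivative_at_within)
  moreover have "0 \<in> interior A" "1 \<in> A"
    using x y \<open>open A\<close> by (auto simp: interior_open A_def l_def)
  ultimately have "f (l 1) - f (l 0) \<ge> (g \<bullet> (y - x)) * (1 - 0)"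
    using convex_connected[OF convex_on_imp_convex[OF cA]]
    by (intro convex_on_imp_above_tangent[OF cA]) auto
  then show ?thesis by (simp add: l_def)
qed

lemma gradient_monotone:
  fixes f :: "'a::real_inner \<Rightarrow> real"
  assumes "convex_on S f" "open S" "x \<in> S" "y \<in> S" "GDERIV f x :> g" "GDERIV f y :> h"
  shows "0 \<le> (g - h) \<bullet> (x - y)"
  using convex_on_imp_above_tangent_plane[OF assms(1,2,3,4,5)]
    convex_on_imp_above_tangent_plane[OF assms(1,2,4,3,6)]
  by (simp add: inner_diff)

text \<open>
  The growth rate is \<open>a / 2\<close> because monotonicity, tested with the point \<open>x\<close> of norm \<open>a / 2\<close> in the
  direction of \<open>p\<close>, bounds \<open>x \<bullet> p\<close> by \<open>\<psi> p \<bullet> p\<close> up to a bounded error.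
\<close>
lemma monotone_inverse_coercive:
  fixes \<phi> \<psi> :: "'a::euclidean_space \<Rightarrow> 'a"
  assumes a: "0 < a" and hom: "homeomorphism (ball 0 a) UNIV \<phi> \<psi>"
    and mono: "\<And>x y. x \<in> ball 0 a \<Longrightarrow> y \<in> ball 0 a \<Longrightarrow> 0 \<le> (\<phi> x - \<phi> y) \<bullet> (x - y)"
  obtains C where "0 \<le> C" "\<And>p. a / 2 * norm p - C \<le> \<psi> p \<bullet> p"
proof -
  have "compact (\<phi> ` cball 0 (a / 2))"
    using a homeomorphism_cont1[OF hom]
    by (intro compact_continuous_image compact_cball) (auto intro: continuous_on_subset)
  then have "bounded (\<phi> ` cball 0 (a / 2))" by (rule compact_imp_bounded)
  then obtain M where "\<forall>x\<in>cball 0 (a / 2). norm (\<phi> x) \<le> M"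
    unfolding bounded_iff by blast
  then have M: "norm (\<phi> x) \<le> M" if "norm x \<le> a / 2" for x
    using that by simp
  have M0: "0 \<le> M" using order_trans[OF norm_ge_zero M[of 0]] a by simp
  show thesis
  proof (rule that[of "M * (2 * a)"])
    fix p :: 'a
    define x where "x = (a / 2) *\<^sub>R sgn p"
    have nx: "norm x \<le> a / 2" using a by (simp add: x_def norm_sgn)
    then have xa: "x \<in> ball 0 a" using a by simp
    have pa: "\<psi> p \<in> ball 0 a" using homeomorphism_image2[OF hom] by blast
    have xp: "x \<bullet> p = a / 2 * norm p"
      by (cases "p = 0") (simp_all add: x_def sgn_div_norm dot_square_norm power2_eq_square)
    have "0 \<le> (p - \<phi> x) \<bullet> (\<psi> p - x)"
      using mono[OF pa xa] homeomorphism_apply2[OF hom, of p] by simp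
    then have "x \<bullet> p \<le> \<psi> p \<bullet> p - \<phi> x \<bullet> (\<psi> p - x)"
      by (simp add: inner_diff inner_commute)
    moreover have "\<bar>\<phi> x \<bullet> (\<psi> p - x)\<bar> \<le> M * (2 * a)"
    proof -
      have "norm (\<psi> p - x) \<le> 2 * a"
        using norm_triangle_ineq4[of "\<psi> p" x] pa nx a by simp
      then have "norm (\<phi> x) * norm (\<psi> p - x) \<le> M * (2 * a)"
        using M[OF nx] M0 by (intro mult_mono) auto
      then show ?thesis
        by (rule order_trans[OF Cauchy_Schwarz_ineq2])
    qed
    ultimately show "a / 2 * norm p - M * (2 * a) \<le> \<psi> p \<bullet> p"
      using xp by linarith
  qed (use a M0 in simp)
qed

section \<open>The a priori bound\<close>

lemma norm_fwd_diff_less: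
  assumes "diff_sup_norm T w < a" "n \<le> T"
  shows "norm (fwd_diff w n) < a"
proof -
  have "norm (fwd_diff w (Suc n - 1)) \<le> diff_sup_norm T w"
    unfolding diff_sup_norm_def using assms(2) by (intro Max_ge finite_imageI imageI) auto
  then show ?thesis using assms(1) by simp
qed

text \<open>
  The quotient in the definition of \<open>\<lambda>\<^sub>1\<close> has numerator at most \<open>(T + 1) * a\<^sup>2\<close>, which bounds the interior
  values. The end values differ from their neighbours by less than \<open>a\<close>.
\<close>
lemma K_set_bounded:
  fixes \<gamma> :: "'a::real_normed_vector \<times> 'a \<Rightarrow> ('a \<times> 'a) set"
  assumes T: "1 \<le> T" and l: "0 < lambda1 T a \<gamma>"
  obtains R where "0 \<le> R" "\<And>w n. w \<in> K_set T a \<gamma> \<Longrightarrow> n \<le> T + 1 \<Longrightarrow> norm (w n) \<le> R"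
proof -
  define L where "L = lambda1 T a \<gamma>"
  define B where "B = sqrt ((T + 1) * a\<^sup>2 / L)"
  have L: "L > 0" using l by (simp add: L_def)
  have B0: "0 \<le> B" using L by (simp add: B_def)
  have inner_bound: "norm (w n) \<le> B" if w: "w \<in> K_set T a \<gamma>" and n: "n \<in> {1..T}" for w n
  proof (cases "w n = 0")
    case False
    define N where "N = (\<Sum>n=1..T+1. (norm (fwd_diff w (n - 1)))\<^sup>2)"
    define M where "M = (\<Sum>n=1..T. (norm (w n))\<^sup>2)"
    have wM: "(norm (w n))\<^sup>2 \<le> M"
      unfolding M_def using n by (intro member_le_sum) auto
    moreover have "0 < (norm (w n))\<^sup>2" using False by simp
    ultimately have M: "0 < M" by linarith
    have "L \<le> N / M"
      unfolding L_def lambda1_def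
    proof (rule cInf_lower)
      show "N / M \<in> {(\<Sum>n=1..T+1. (norm (fwd_diff w (n - 1)))\<^sup>2) / (\<Sum>n=1..T. (norm (w n))\<^sup>2)
         | w. w \<in> K_set T a \<gamma> \<and> (\<exists>n\<in>{1..T}. w n \<noteq> 0)}"
        using w n False unfolding N_def M_def by blast
      show "bdd_below {(\<Sum>n=1..T+1. (norm (fwd_diff w (n - 1)))\<^sup>2) / (\<Sum>n=1..T. (norm (w n))\<^sup>2)
         | w. w \<in> K_set T a \<gamma> \<and> (\<exists>n\<in>{1..T}. w n \<noteq> 0)}"
        by (rule bdd_belowI[of _ 0])
          (auto simp del: sum.cl_ivl_Suc intro!: divide_nonneg_nonneg sum_nonneg)
    qed
    then have MN: "M \<le> N / L" using M L by (simp add: field_simps)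
    have "N \<le> (T + 1) * a\<^sup>2"
    proof -
      have "(norm (fwd_diff w (k - 1)))\<^sup>2 \<le> a\<^sup>2" if "k \<in> {1..T+1}" for k
      proof -
        have "k - 1 \<le> T" using that by auto
        moreover have "diff_sup_norm T w < a" using w by (simp add: K_set_def)
        ultimately have "norm (fwd_diff w (k - 1)) < a"
          by (rule norm_fwd_diff_less[rotated])
        then show ?thesis by (rule power_mono[OF less_imp_le norm_ge_zero])
      qed
      then have "N \<le> of_nat (card {1..T+1}) * a\<^sup>2"
        unfolding N_def by (rule sum_bounded_above)
      then show ?thesis by simp
    qed
    then have "N / L \<le> (T + 1) * a\<^sup>2 / L"
      by (rule divide_right_mono) (use L in simp)
    with MN have "M \<le> (T + 1) * a\<^sup>2 / L" by (rule order_trans)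
    then show ?thesis
      using wM unfolding B_def by (intro real_le_rsqrt) linarith
  qed (use B0 in simp)
  show thesis
  proof (rule that[of "B + \<bar>a\<bar>"])
    fix w :: "nat \<Rightarrow> 'a" and n assume w: "w \<in> K_set T a \<gamma>" and n: "n \<le> T + 1"
    have d: "norm (w (Suc k) - w k) \<le> \<bar>a\<bar>" if "k \<le> T" for k
      using norm_fwd_diff_less[of T w a k] w that by (simp add: K_set_def fwd_diff_def)
    consider "n = 0" | "n \<in> {1..T}" | "n = Suc T" using n by force
    then show "norm (w n) \<le> B + \<bar>a\<bar>"
    proof cases
      case 1
      then show ?thesis
        using inner_bound[OF w, of 1] T d[of 0] norm_triangle_sub[of "w 0" "w 1"]
        by (simp add: norm_minus_commute)
    next
      case 2
      then show ?thesis using inner_bound[OF w 2] abs_ge_zero[of a] by linarith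
    next
      case 3
      then show ?thesis
        using inner_bound[OF w, of T] T d[of T] norm_triangle_sub[of "w (Suc T)" "w T"] by simp
    qed
  qed (use B0 in simp)
qed

section \<open>Solutions of the difference problem\<close>

lemma summation_by_parts:
  fixes p u :: "nat \<Rightarrow> 'a::real_inner"
  shows "(\<Sum>k=0..T+1. ((if k \<le> T then - p (k + 1) else 0) + (if 1 \<le> k then p k else 0)) \<bullet> u k)
    = (\<Sum>n=1..T+1. p n \<bullet> (u n - u (n - 1)))"
proof -
  have "(\<Sum>k=0..T+1. (if k \<le> T then - p (k + 1) else 0) \<bullet> u k) = (\<Sum>k=0..T. - p (k + 1) \<bullet> u k)"
    by simp
  also have "\<dots> = (\<Sum>n=1..T+1. - p n \<bullet> u (n - 1))"
    using sum.shift_bounds_cl_nat_ivl[of "\<lambda>n. - p n \<bullet> u (n - 1)" 0 1 T] by simp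
  finally have 1: "(\<Sum>k=0..T+1. (if k \<le> T then - p (k + 1) else 0) \<bullet> u k) = (\<Sum>n=1..T+1. - p n \<bullet> u (n - 1))" .
  have 2: "(\<Sum>k=0..T+1. (if 1 \<le> k then p k else 0) \<bullet> u k) = (\<Sum>n=1..T+1. p n \<bullet> u n)"
    by (subst sum.atLeast_Suc_atMost) (auto intro!: sum.cong)
  show ?thesis
    unfolding inner_add_left sum.distrib 1 2 inner_diff_right
    by (simp add: sum_negf sum_subtractf del: sum.cl_ivl_Suc)
qed

lemma quadratic_ge_linear:
  fixes s :: real
  shows "s - (c + 1)\<^sup>2 / 4 \<le> s\<^sup>2 - c * s"
proof -
  have "0 \<le> (s - (c + 1) / 2)\<^sup>2" by simp
  then show ?thesis by (simp add: power2_eq_square field_simps)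
qed

theorem theorem3p1:
  fixes T :: nat and a :: real
    and \<phi> :: "real ^ 'n \<Rightarrow> real ^ 'n"
    and \<Phi> :: "real ^ 'n \<Rightarrow> real"
    and \<gamma> :: "(real ^ 'n) \<times> (real ^ 'n) \<Rightarrow> ((real ^ 'n) \<times> (real ^ 'n)) set"
    and f :: "nat \<Rightarrow> (nat \<Rightarrow> real ^ 'n) \<Rightarrow> real ^ 'n"
  assumes "T \<ge> 2" and "a > 0"
    and "\<exists>\<psi>. homeomorphism (ball 0 a) UNIV \<phi> \<psi>" and "\<phi> 0 = 0"
    and "\<forall>x\<in>ball 0 a. GDERIV \<Phi> x :> \<phi> x"
    and "C1_on \<Phi> (ball 0 a)" and "continuous_on (cball 0 a) \<Phi>"
    and "strictly_convex_on (cball 0 a) \<Phi>" and "\<Phi> 0 = 0"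
    and "maximal_monotone \<gamma>" and "(0, 0) \<in> \<gamma> (0, 0)"
    and "\<forall>n\<in>{1..T}. continuous_map (product_topology (\<lambda>_. euclidean) {0..T+1}) euclidean (f n)"
    and "lambda1 T a \<gamma> > 0"
  shows "\<exists>u. is_solution T a \<phi> \<gamma> f u"
proof -
  obtain \<psi> where hom: "homeomorphism (ball 0 a) UNIV \<phi> \<psi>"
    using assms(3) by blast
  have "convex_on (ball 0 a) \<Phi>"
    using strictly_convex_on_imp_convex_on[OF assms(8)]
    by (rule convex_on_subset) auto
  then have mono: "0 \<le> (\<phi> x - \<phi> y) \<bullet> (x - y)" if "x \<in> ball 0 a" "y \<in> ball 0 a" for x y
    using gradient_monotone[OF _ open_ball that] assms(5) that by blast
  obtain C where C: "0 \<le> C" "\<And>p. a / 2 * norm p - C \<le> \<psi> p \<bullet> p"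
  proof (rule monotone_inverse_coercive[OF assms(2) hom])
    show "0 \<le> (\<phi> x - \<phi> y) \<bullet> (x - y)" if "x \<in> ball 0 a" "y \<in> ball 0 a" for x y
      using that by (rule mono)
  qed (rule that)
  obtain R where R: "0 \<le> R" "\<And>w n. w \<in> K_set T a \<gamma> \<Longrightarrow> n \<le> T + 1 \<Longrightarrow> norm (w n) \<le> R"
  proof (rule K_set_bounded[OF _ assms(13)])
    show "1 \<le> T" using assms(1) by simp
  qed (rule that)

  \<comment> \<open>\<open>tr x\<close> is the part \<open>u\<close> of \<open>x = (u, p)\<close> with its values projected to the ball of radius \<open>R\<close>.\<close>
  define P :: "real ^ 'n \<Rightarrow> real ^ 'n" where "P = closest_point (cball 0 R)"
  have P_norm: "norm (P v) \<le> R" for v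
    using closest_point_in_set[of "cball 0 R" v] R(1) by (simp add: P_def)
  have P_id: "P v = v" if "norm v \<le> R" for v
    using that by (simp add: P_def closest_point_self)
  have P_cont: "continuous_on S P" for S
    unfolding P_def using R(1) by (intro continuous_on_closest_point) auto
  define tr where "tr x = restrict (\<lambda>k. P (x (Inl k))) {0..T+1}" for x :: "nat + nat \<Rightarrow> real ^ 'n"

  have f_cont: "continuous_on UNIV (\<lambda>x. f n (tr x))" if "n \<in> {1..T}" for n
  proof -
    have "continuous_map euclidean (product_topology (\<lambda>_. euclidean) {0..T+1}) tr"
      unfolding continuous_map_componentwise tr_def
      by (auto intro!: continuous_on_compose2[OF P_cont[of UNIV]] continuous_on_product_coordinates
          simp: continuous_map_iff_continuous2)
    from continuous_map_compose[OF this assms(12)[rule_format, OF that]]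
    show ?thesis by (simp add: o_def continuous_map_iff_continuous2)
  qed
  have "bounded (\<Union>n\<in>{1..T}. f n ` (PiE {0..T+1} (\<lambda>_. cball 0 R)))"
  proof (rule bounded_UN)
    show "\<forall>n\<in>{1..T}. bounded (f n ` (PiE {0..T+1} (\<lambda>_. cball 0 R)))"
    proof
      fix n assume "n \<in> {1..T}"
      then have "compactin euclidean (f n ` (PiE {0..T+1} (\<lambda>_. cball 0 R)))"
        using assms(12) by (intro image_compactin) (auto simp: compactin_PiE)
      then show "bounded (f n ` (PiE {0..T+1} (\<lambda>_. cball 0 R)))"
        by (simp add: compact_imp_bounded)
    qed
  qed simp
  then obtain M' where "\<forall>y\<in>(\<Union>n\<in>{1..T}. f n ` (PiE {0..T+1} (\<lambda>_. cball 0 R))). norm y \<le> M'"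
    unfolding bounded_iff by blast
  moreover have "tr x \<in> PiE {0..T+1} (\<lambda>_. cball 0 R)" for x
    using P_norm by (auto simp: tr_def)
  ultimately have M': "norm (f n (tr x)) \<le> M'" if "n \<in> {1..T}" for n x
    using that by blast
  define M where "M = max 0 M'"
  define F where "F k x = (if k \<in> {1..T} then f k (tr x) else 0)" for k x
  have F_norm: "norm (F k x) \<le> M" for k x
    using M' by (auto simp: F_def M_def le_max_iff_disj)

  \<comment> \<open>The coordinate \<open>Inl k\<close> of \<open>x\<close> is \<open>u k\<close>, and \<open>Inr n\<close> is the flux \<open>p n\<close>. In \<open>flux\<close> the missing
    neighbour at either end contributes zero, which leaves \<open>- p 1\<close> at \<open>0\<close> and \<open>p (T + 1)\<close> at \<open>T + 1\<close>.\<close>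
  define flux where "flux k x = (if k \<le> T then - x (Inr (k + 1)) else 0) + (if 1 \<le> k then x (Inr k) else 0)"
    for k :: nat and x :: "nat + nat \<Rightarrow> real ^ 'n"
  define V where "V x i = (case i of
      Inl k \<Rightarrow> flux k x + (x (Inl k) - P (x (Inl k)) - F k x)
    | Inr n \<Rightarrow> \<psi> (x (Inr n)) - (x (Inl n) - x (Inl (n - 1))))" for x i
  define I where "I = {0..T+1} <+> {1..T+1}"
  have finI: "finite I" by (simp add: I_def)
  have V_cont: "continuous_on UNIV (\<lambda>x. V x i)" for i
  proof (cases i)
    case (Inl k)
    have "continuous_on UNIV (\<lambda>x. F k x)"
      using f_cont by (cases "k \<in> {1..T}") (auto simp: F_def)
    moreover have "continuous_on UNIV (\<lambda>x. flux k x)"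
      unfolding flux_def
      by (cases "k \<le> T"; cases "1 \<le> k"; simp; intro continuous_intros continuous_on_product_coordinates)
    ultimately show ?thesis
      unfolding V_def Inl sum.case
      by (intro continuous_intros continuous_on_compose2[OF P_cont[of UNIV]] continuous_on_product_coordinates) auto
  next
    case (Inr n)
    show ?thesis
      unfolding V_def Inr sum.case
      by (intro continuous_intros continuous_on_compose2[OF homeomorphism_cont2[OF hom]]
          continuous_on_product_coordinates) auto
  qed

  \<comment> \<open>Each summand of \<open>V x \<bullet> x\<close> that survives summation by parts is at least \<open>b * norm (x i) - D\<close>.\<close>
  define b where "b = min 1 (a / 2)"
  define D where "D = (R + M + 1)\<^sup>2 / 4 + C"
  have b: "0 < b" "b \<le> 1" "b \<le> a / 2" using assms(2) by (auto simp: b_def)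
  define q where "q x i = (case i of
      Inl k \<Rightarrow> (x (Inl k) - P (x (Inl k)) - F k x) \<bullet> x (Inl k)
    | Inr n \<Rightarrow> \<psi> (x (Inr n)) \<bullet> x (Inr n))" for x i
  have Vq: "(\<Sum>i\<in>I. V x i \<bullet> x i) = (\<Sum>i\<in>I. q x i)" for x
  proof -
    have "(\<Sum>k=0..T+1. flux k x \<bullet> x (Inl k)) = (\<Sum>n=1..T+1. x (Inr n) \<bullet> (x (Inl n) - x (Inl (n - 1))))"
      unfolding flux_def by (rule summation_by_parts[of T "\<lambda>n. x (Inr n)" "\<lambda>k. x (Inl k)"])
    moreover have "(\<Sum>k=0..T+1. V x (Inl k) \<bullet> x (Inl k))
        = (\<Sum>k=0..T+1. flux k x \<bullet> x (Inl k)) + (\<Sum>k=0..T+1. q x (Inl k))"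
      by (simp add: V_def q_def inner_add_left sum.distrib del: sum.cl_ivl_Suc)
    moreover have "(\<Sum>n=1..T+1. V x (Inr n) \<bullet> x (Inr n))
        = (\<Sum>n=1..T+1. q x (Inr n)) - (\<Sum>n=1..T+1. x (Inr n) \<bullet> (x (Inl n) - x (Inl (n - 1))))"
      unfolding sum_subtractf[symmetric]
      by (intro sum.cong) (simp_all add: V_def q_def inner_diff_left inner_diff_right inner_commute)
    ultimately show ?thesis
      unfolding I_def sum.Plus[OF finite_atLeastAtMost finite_atLeastAtMost] o_def by linarith
  qed
  have q_ge: "b * norm (x i) - D \<le> q x i" for x i
  proof (cases i)
    case (Inl k)
    let ?v = "x (Inl k)"
    have "\<bar>(P ?v + F k x) \<bullet> ?v\<bar> \<le> (R + M) * norm ?v"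
      by (rule order_trans[OF Cauchy_Schwarz_ineq2 mult_right_mono])
        (use norm_triangle_mono[OF P_norm F_norm] in auto)
    then have "(norm ?v)\<^sup>2 - (R + M) * norm ?v \<le> q x i"
      by (simp add: q_def Inl inner_diff_left inner_add_left dot_square_norm)
    moreover have "norm ?v - (R + M + 1)\<^sup>2 / 4 \<le> (norm ?v)\<^sup>2 - (R + M) * norm ?v"
      by (rule quadratic_ge_linear)
    moreover have "b * norm ?v \<le> norm ?v"
      using b by (simp add: mult_left_le_one_le)
    ultimately show ?thesis using C(1) unfolding D_def Inl by linarith
  next
    case (Inr n)
    have "b * norm (x i) \<le> a / 2 * norm (x i)"
      using b by (intro mult_right_mono) auto
    moreover have "a / 2 * norm (x i) - C \<le> q x i"
      using C(2)[of "x i"] by (simp add: q_def Inr)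
    moreover have "0 \<le> (R + M + 1)\<^sup>2 / 4" by simp
    ultimately show ?thesis unfolding D_def by linarith
  qed
  have V_bound: "norm (x i) \<le> D * card I / b" if "(\<Sum>i\<in>I. V x i \<bullet> x i) \<le> 0" "i \<in> I" for x i
  proof -
    have "b * norm (x i) \<le> (\<Sum>i\<in>I. b * norm (x i))"
      using finI that(2) b by (intro member_le_sum) auto
    also have "\<dots> = (\<Sum>i\<in>I. b * norm (x i) - D) + D * card I"
      by (simp add: sum_subtractf)
    also have "(\<Sum>i\<in>I. b * norm (x i) - D) \<le> (\<Sum>i\<in>I. q x i)"
      by (intro sum_mono q_ge)
    also have "\<dots> \<le> 0" using that(1) Vq by simp
    finally show ?thesis using b by (simp add: field_simps)
  qed

  obtain x where bc: "(- V x (Inl 0), - V x (Inl (T + 1))) \<in> \<gamma> (x (Inl 0), x (Inl (T + 1)))"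
    and V0: "\<And>i. i \<in> I - {Inl 0, Inl (T + 1)} \<Longrightarrow> V x i = 0"
  proof (rule coercive_inclusion_solvable[of I "Inl 0" "Inl (T + 1)" \<gamma> V "D * card I / b"])
    show "Inl 0 \<in> I" "Inl (T + 1) \<in> I" "(Inl 0 :: nat + nat) \<noteq> Inl (T + 1)"
      by (auto simp: I_def)
    show "norm (x i) \<le> D * card I / b" if "(\<Sum>i\<in>I. V x i \<bullet> x i) \<le> 0" "i \<in> I" for x i
      using that by (rule V_bound)
  qed (rule finI assms(10,11) V_cont that; assumption?)+

  define u where "u = restrict (\<lambda>k. x (Inl k)) {0..T+1}"
  have \<psi>_diff: "fwd_diff u n = \<psi> (x (Inr (n + 1)))" if "n \<le> T" for n
  proof -
    have "V x (Inr (n + 1)) = 0"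
      using that by (intro V0) (auto simp: I_def)
    then show ?thesis
      using that by (simp add: V_def u_def fwd_diff_def)
  qed
  have flux_u: "x (Inr (n + 1)) = \<phi> (fwd_diff u n)" if "n \<le> T" for n
    using homeomorphism_apply2[OF hom] by (simp add: \<psi>_diff[OF that])
  have "norm (fwd_diff u n) < a" if "n \<le> T" for n
    using homeomorphism_image2[OF hom] \<psi>_diff[OF that] by (auto simp: set_eq_iff image_iff)
  then have sup: "diff_sup_norm T u < a"
    unfolding diff_sup_norm_def by (subst Max_less_iff) auto
  have dom: "(u 0, u (T + 1)) \<in> op_domain \<gamma>"
    using bc by (auto simp: op_domain_def u_def)
  have grid: "u \<in> grid_functions T"
    by (auto simp: u_def grid_functions_def)
  \<comment> \<open>The a priori bound applies, so the modification of \<open>f\<close> is not felt by \<open>u\<close>.\<close>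
  then have "u \<in> K_set T a \<gamma>"
    using sup dom by (simp add: K_set_def)
  then have "norm (x (Inl k)) \<le> R" if "k \<le> T + 1" for k
    using R(2)[of u k] that by (simp add: u_def)
  then have Px: "P (x (Inl k)) = x (Inl k)" if "k \<le> T + 1" for k
    using that P_id by blast
  have tru: "tr x = u"
    unfolding tr_def u_def using Px by (intro restrict_ext) auto
  have "- fwd_diff (\<lambda>k. \<phi> (fwd_diff u k)) (n - 1) = f n u" if n: "n \<in> {1..T}" for n
  proof -
    have "V x (Inl n) = 0"
      using n by (intro V0) (auto simp: I_def)
    then have "x (Inr n) - x (Inr (n + 1)) = f n u"
      using n Px[of n] by (simp add: V_def flux_def F_def tru)
    moreover have "x (Inr n) = \<phi> (fwd_diff u (n - 1))" "x (Inr (n + 1)) = \<phi> (fwd_diff u n)"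
      using flux_u[of "n - 1"] flux_u[of n] n by auto
    ultimately show ?thesis
      using n by (simp add: fwd_diff_def[of "\<lambda>k. \<phi> (fwd_diff u k)"])
  qed
  moreover have "(\<phi> (fwd_diff u 0), - \<phi> (fwd_diff u T)) \<in> \<gamma> (u 0, u (T + 1))"
  proof -
    have "- V x (Inl 0) = \<phi> (fwd_diff u 0)"
      using flux_u[of 0] Px[of 0] by (simp add: V_def flux_def F_def)
    moreover have "- V x (Inl (T + 1)) = - \<phi> (fwd_diff u T)"
      using flux_u[of T] Px[of "T + 1"] by (simp add: V_def flux_def F_def)
    ultimately show ?thesis using bc by (simp add: u_def)
  qed
  ultimately show ?thesis
    unfolding is_solution_def using grid sup dom by blast
qed

end
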